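(* Let $n\geq 3$ be an integer. Then the ring $\mathbb{T}_n(\mathbb{F}_2)$ is $n$-torsion clean if and only if $\mathbb{T}_n(\mathbb{F}_2)$ is almost $n$-torsion clean.
   Context: $\mathbb{F}_2$ is the field with two elements and $\mathbb{T}_n(\mathbb{F}_2)$ is the ring of all upper triangular $n\times n$ matrices over $\mathbb{F}_2$. For a positive integer $m$, a ring $R$ with identity $1\neq 0$ is called almost $m$-torsion clean if for every $r\in R$ there exist a unit $u\in R$ with $u^m=1$ and an idempotent $e\in R$ (i.e. $e^2=e$) such that $r=u+e$. The ring $R$ is called $m$-torsion clean if it is almost $m$-torsion clean and $m$ is the smallest positive integer with this property (i.e. $R$ is not almost $m'$-torsion clean for any positive integer $m'<m$). *)

theory Defs
  imports "HOL-Library.Z2" "HOL-Algebra.Subrings" "Jordan_Normal_Form.Matrix"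
begin

definition upper_triangular_ring :: "'a :: comm_ring_1 itself \<Rightarrow> nat \<Rightarrow> 'a mat ring" where
  "upper_triangular_ring ty n =
     (ring_mat ty n ())\<lparr>carrier := {A \<in> carrier_mat n n. upper_triangular A}\<rparr>"

(* The type bit of HOL-Library.Z2 is the two-element field. *)
abbreviation T_F2 :: "nat \<Rightarrow> bit mat ring" where
  "T_F2 n \<equiv> upper_triangular_ring TYPE(bit) n"

definition almost_torsion_clean :: "nat \<Rightarrow> ('a, 'b) ring_scheme \<Rightarrow> bool" where
  "almost_torsion_clean m R \<longleftrightarrow>
     0 < m \<and> ring R \<and> \<one>\<^bsub>R\<^esub> \<noteq> \<zero>\<^bsub>R\<^esub> \<and>
     (\<forall>r \<in> carrier R. \<exists>u \<in> Units R. \<exists>e \<in> carrier R.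
        u [^]\<^bsub>R\<^esub> m = \<one>\<^bsub>R\<^esub> \<and> e \<otimes>\<^bsub>R\<^esub> e = e \<and> r = u \<oplus>\<^bsub>R\<^esub> e)"

definition torsion_clean :: "nat \<Rightarrow> ('a, 'b) ring_scheme \<Rightarrow> bool" where
  "torsion_clean m R \<longleftrightarrow>
     almost_torsion_clean m R \<and>
     (\<forall>m'. 0 < m' \<and> m' < m \<longrightarrow> \<not> almost_torsion_clean m' R)"

lemma upper_triangular_mult:
  fixes A B :: "'a :: comm_ring_1 mat"
  assumes "A \<in> carrier_mat n n" "B \<in> carrier_mat n n"
    and "upper_triangular A" "upper_triangular B"
  shows "upper_triangular (A * B)"
proof (rule upper_triangularI)
  fix i j assume ji: "j < i" and "i < dim_row (A * B)"
  then have i: "i < n" using assms by simp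
  have "A $$ (i, k) * B $$ (k, j) = 0" if "k < n" for k
  proof (cases "k < i")
    case True
    then show ?thesis using assms i by (simp add: upper_triangularD)
  next
    case False
    then show ?thesis using assms ji that by (simp add: upper_triangularD)
  qed
  then show "(A * B) $$ (i, j) = 0"
    using assms i ji by (auto simp: scalar_prod_def intro!: sum.neutral)
qed

lemma upper_triangular_add:
  fixes A B :: "'a :: comm_ring_1 mat"
  assumes "A \<in> carrier_mat n n" "B \<in> carrier_mat n n"
    and "upper_triangular A" "upper_triangular B"
  shows "upper_triangular (A + B)"
  using assms by (intro upper_triangularI) (auto simp: upper_triangularD)

lemma upper_triangular_uminus:
  fixes A :: "'a :: comm_ring_1 mat"
  assumes "A \<in> carrier_mat n n" "upper_triangular A"
  shows "upper_triangular (- A)"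
  using assms by (intro upper_triangularI) (auto simp: upper_triangularD)

lemma ring_upper_triangular: "ring (upper_triangular_ring TYPE('a :: comm_ring_1) n)"
proof -
  let ?M = "ring_mat TYPE('a) n ()"
  let ?T = "{A \<in> carrier_mat n n. upper_triangular (A :: 'a mat)}"
  interpret M: ring ?M by (rule ring_mat)
  have minus: "\<ominus>\<^bsub>?M\<^esub> A = - A" if "A \<in> carrier_mat n n" for A
    by (rule M.minus_equality) (use that in \<open>auto simp: ring_mat_simps\<close>)
  have "subring ?T ?M"
    by (rule M.subringI)
       (auto simp: ring_mat_simps minus upper_triangular_add upper_triangular_uminus
          upper_triangular_mult)
  then show ?thesis
    unfolding upper_triangular_ring_def by (rule M.subring_is_ring)
qed

lemma upper_triangular_ring_nontrivial:
  assumes "0 < n"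
  shows "\<one>\<^bsub>upper_triangular_ring TYPE('a :: comm_ring_1) n\<^esub> \<noteq>
         \<zero>\<^bsub>upper_triangular_ring TYPE('a) n\<^esub>"
proof
  assume "\<one>\<^bsub>upper_triangular_ring TYPE('a) n\<^esub> = \<zero>\<^bsub>upper_triangular_ring TYPE('a) n\<^esub>"
  then have "(1\<^sub>m n :: 'a mat) $$ (0, 0) = 0\<^sub>m n n $$ (0, 0)"
    by (simp add: upper_triangular_ring_def ring_mat_def)
  then show False using assms by simp
qed

end

theory Submission
  imports Defs "Jordan_Normal_Form.Jordan_Normal_Form"
begin

text \<open>
  Almost \<open>m\<close>-torsion cleanness of \<open>T_F2 n\<close> already forces \<open>m \<ge> n\<close>, so an exponent \<open>n\<close> that works
  is automatically the smallest one. The obstruction is the Jordan block \<open>J\<close> of size \<open>n\<close> with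
  eigenvalue \<open>1\<close>. Write \<open>J = U + E\<close> with \<open>U\<close> a unit and \<open>E\<close> idempotent. As \<open>1\<close> is the only unit
  of the field, \<open>U\<close> has ones on its diagonal, hence \<open>E\<close> has zeros there. So \<open>E\<close> is nilpotent as
  well as idempotent, i.e. \<open>E = 0\<close> and \<open>J = U\<close>. But the entry of \<open>J\<^sup>m\<close> at distance \<open>m\<close> from the
  diagonal is \<open>m choose m = 1\<close>, which contradicts \<open>U\<^sup>m = 1\<close> if this entry lies inside the matrix,
  that is, if \<open>0 < m < n\<close>.
\<close>

lemma upper_triangular_mult_diagonal:
  fixes A B :: "'a :: comm_ring_1 mat"
  assumes "A \<in> carrier_mat n n" "B \<in> carrier_mat n n"
    and "upper_triangular A" "upper_triangular B" and "i < n"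
  shows "(A * B) $$ (i, i) = A $$ (i, i) * B $$ (i, i)"
proof -
  have "(A * B) $$ (i, i) = (\<Sum>k\<in>{0..<n}. A $$ (i, k) * B $$ (k, i))"
    using assms by (simp add: scalar_prod_def)
  also have "\<dots> = (\<Sum>k\<in>{0..<n}. if k = i then A $$ (i, i) * B $$ (i, i) else 0)"
  proof (rule sum.cong)
    fix k assume "k \<in> {0..<n}"
    then show "A $$ (i, k) * B $$ (k, i) = (if k = i then A $$ (i, i) * B $$ (i, i) else 0)"
      using assms upper_triangularD[of A k i] upper_triangularD[of B i k]
      by (cases k i rule: linorder_cases) auto
  qed simp
  finally show ?thesis using assms by simp
qed

text \<open>
  In \<open>E = E\<^sup>2\<close> an entry at distance \<open>j - i\<close> from the diagonal is a sum of products of entries at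
  strictly smaller distances, so all entries vanish by induction on the distance.
\<close>

lemma strictly_upper_triangular_idempotent_eq_0:
  fixes E :: "'a :: comm_ring_1 mat"
  assumes E: "E \<in> carrier_mat n n" and tri: "upper_triangular E"
    and diag: "\<And>i. i < n \<Longrightarrow> E $$ (i, i) = 0" and idem: "E * E = E"
  shows "E = 0\<^sub>m n n"
proof -
  have "E $$ (i, j) = 0" if "i < n" "j < n" for i j
    using that
  proof (induction "j - i" arbitrary: i j rule: less_induct)
    case less
    have "E $$ (i, k) * E $$ (k, j) = 0" if "k < n" for k
    proof (cases "i < k \<and> k < j")
      case True
      then have "k - i < j - i" by linarith
      then show ?thesis using less that by simp
    next
      case False
      then consider "k < i" | "k = i" | "k = j" | "j < k" by linarith
      then show ?thesis
        using E tri diag less.prems that by cases (simp_all add: upper_triangularD)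
    qed
    then have "(E * E) $$ (i, j) = 0"
      using E less.prems by (auto simp: scalar_prod_def intro!: sum.neutral)
    then show ?case by (simp add: idem)
  qed
  then show ?thesis using E by (intro eq_matI) auto
qed

lemma upper_triangular_ring_simps:
  "carrier (upper_triangular_ring TYPE('a :: comm_ring_1) n) =
     {A \<in> carrier_mat n n. upper_triangular A}"
  "x \<otimes>\<^bsub>upper_triangular_ring TYPE('a) n\<^esub> y = x * y"
  "x \<oplus>\<^bsub>upper_triangular_ring TYPE('a) n\<^esub> y = x + y"
  "\<one>\<^bsub>upper_triangular_ring TYPE('a) n\<^esub> = 1\<^sub>m n"
  by (simp_all add: upper_triangular_ring_def ring_mat_def)

lemma upper_triangular_ring_pow:
  fixes A :: "'a :: comm_ring_1 mat" and k :: nat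
  assumes "A \<in> carrier_mat n n"
  shows "A [^]\<^bsub>upper_triangular_ring TYPE('a) n\<^esub> k = A ^\<^sub>m k"
  using assms by (induction k) (auto simp: upper_triangular_ring_simps nat_pow_def)

lemma Units_T_F2_diagonal:
  assumes U: "U \<in> Units (T_F2 n)" and i: "i < n"
  shows "U $$ (i, i) = 1"
proof -
  obtain V where V: "V \<in> carrier_mat n n" "upper_triangular V" and UV: "U * V = 1\<^sub>m n"
    using U by (auto simp: Units_def upper_triangular_ring_simps)
  have U': "U \<in> carrier_mat n n" "upper_triangular U"
    using U by (auto simp: Units_def upper_triangular_ring_simps)
  have "U $$ (i, i) * V $$ (i, i) = 1"
    using upper_triangular_mult_diagonal[OF U'(1) V(1) U'(2) V(2) i] i by (simp add: UV)
  then show ?thesis by (cases "U $$ (i, i)") auto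
qed

lemma unipotent_clean_decomposition_T_F2:
  assumes A: "A \<in> carrier_mat n n" and diag: "\<And>i. i < n \<Longrightarrow> A $$ (i, i) = 1"
    and U: "U \<in> Units (T_F2 n)"
    and E: "E \<in> carrier (T_F2 n)" "E * E = E" and sum: "A = U + E"
  shows "U = A"
proof -
  have U': "U \<in> carrier_mat n n" and E': "E \<in> carrier_mat n n" "upper_triangular E"
    using U E by (auto simp: Units_def upper_triangular_ring_simps)
  have "E $$ (i, i) = 0" if i: "i < n" for i
  proof -
    have "1 + E $$ (i, i) = 1"
      using diag[OF i] U' E' i Units_T_F2_diagonal[OF U i] by (simp add: sum)
    then show ?thesis by (cases "E $$ (i, i)") auto
  qed
  then have "E = 0\<^sub>m n n"
    using E' E(2) by (intro strictly_upper_triangular_idempotent_eq_0)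
  then show ?thesis using sum U' by simp
qed

lemma jordan_block_1_pow_neq_1:
  assumes "0 < m" "m < n"
  shows "(jordan_block n (1 :: 'a :: comm_ring_1)) ^\<^sub>m m \<noteq> 1\<^sub>m n"
proof
  assume "(jordan_block n (1 :: 'a)) ^\<^sub>m m = 1\<^sub>m n"
  then have "((jordan_block n (1 :: 'a)) ^\<^sub>m m) $$ (0, m) = 1\<^sub>m n $$ (0, m)" by simp
  then show False using assms by (simp add: jordan_block_pow)
qed

lemma almost_torsion_clean_T_F2_imp_le:
  assumes clean: "almost_torsion_clean m (T_F2 n)"
  shows "n \<le> m"
proof (rule ccontr)
  assume "\<not> n \<le> m"
  moreover have "0 < m" using clean by (simp add: almost_torsion_clean_def)
  ultimately have m: "0 < m" "m < n" by simp_all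
  define J :: "bit mat" where "J = jordan_block n 1"
  have J: "J \<in> carrier_mat n n" "upper_triangular J"
    by (auto simp: J_def jordan_block_def)
  then have "J \<in> carrier (T_F2 n)" by (simp add: upper_triangular_ring_simps)
  then obtain U E where U: "U \<in> Units (T_F2 n)" and E: "E \<in> carrier (T_F2 n)"
    and pow: "U [^]\<^bsub>T_F2 n\<^esub> m = 1\<^sub>m n" and idem: "E * E = E" and sum: "J = U + E"
    using clean unfolding almost_torsion_clean_def upper_triangular_ring_simps by blast
  have "U = J"
    by (rule unipotent_clean_decomposition_T_F2[OF J(1) _ U E idem sum])
       (simp add: J_def jordan_block_def)
  then have "J ^\<^sub>m m = 1\<^sub>m n" using pow J by (simp add: upper_triangular_ring_pow)
  then show False using jordan_block_1_pow_neq_1[OF m, where ?'a = bit] by (simp add: J_def)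
qed

theorem corollary2p18:
  fixes n :: nat
  assumes "n \<ge> 3"
  shows "torsion_clean n (T_F2 n) \<longleftrightarrow> almost_torsion_clean n (T_F2 n)"
  using almost_torsion_clean_T_F2_imp_le by (fastforce simp: torsion_clean_def)

end
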